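(* Let $N\ge3$ be an integer and let $$A=\bigcup_{r=1}^{N}\Big[\,2\Big\lfloor\frac{2N}{r}\Big\rfloor\Big]_0\times[2r]_0\subseteq\mathbb{Z}^2 .$$ Consider the class of all polygonal regions $P\subseteq[0,1)^2$, with vertices in $[0,1)^2$, having at most $N$ vertices and all of whose edges are parallel to the $x$-axis or the $y$-axis. Then every $P$ in this class is determined, within the class, by the values of $\widehat{\mathbb{1}_P}$ on $A$: if $P,Q$ belong to the class and $\widehat{\mathbb{1}_P}(a)=\widehat{\mathbb{1}_Q}(a)$ for all $a\in A$, then $P=Q$.
   Context: For an integer $m\ge0$, $[m]_0=\{0,1,\ldots,m\}$. A polygonal region is given by an ordered sequence of vertices $v_0,\ldots,v_{n-1}\in\mathbb{R}^2$ ($n\ge 3$) which, joined cyclically by line segments (edges) $v_jv_{j+1}$ (indices mod $n$) that do not intersect except at the vertices, form a simple closed polygonal curve; successive edges are not parallel. The polygonal region is the interior (the bounded open region enclosed) of this curve. $\mathbb{1}_P$ is the indicator function of $P$ and $\widehat{g}(t)=\int_{\mathbb{R}^2}g(x)e^{-2\pi i x\cdot t}\,dx$. *)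

theory Defs
  imports "HOL-Analysis.Analysis"
begin

definition parallel :: "real \<times> real \<Rightarrow> real \<times> real \<Rightarrow> bool" where
  "parallel u w \<longleftrightarrow> (\<exists>c. c \<noteq> 0 \<and> u = c *\<^sub>R w)"

text \<open>A polygon is given by the list of its vertices; indices are taken modulo the length.\<close>

definition vertex :: "(real \<times> real) list \<Rightarrow> nat \<Rightarrow> real \<times> real" where
  "vertex vs j = vs ! (j mod length vs)"

definition edge :: "(real \<times> real) list \<Rightarrow> nat \<Rightarrow> (real \<times> real) set" where
  "edge vs j = closed_segment (vertex vs j) (vertex vs (Suc j))"

definition edge_vector :: "(real \<times> real) list \<Rightarrow> nat \<Rightarrow> real \<times> real" where
  "edge_vector vs j = vertex vs (Suc j) - vertex vs j"

text \<open>
  Two different edges may only meet in a common endpoint. Together with the vertices being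
  pairwise different this says that the edges form a simple closed curve; in particular a
  vertex cannot lie on an edge of which it is not an endpoint.
\<close>

definition simple_polygon :: "(real \<times> real) list \<Rightarrow> bool" where
  "simple_polygon vs \<longleftrightarrow>
     length vs \<ge> 3 \<and> distinct vs \<and>
     (\<forall>i < length vs. \<forall>j < length vs. i \<noteq> j \<longrightarrow>
        edge vs i \<inter> edge vs j
          \<subseteq> {vertex vs i, vertex vs (Suc i)} \<inter> {vertex vs j, vertex vs (Suc j)}) \<and>
     (\<forall>j < length vs. \<not> parallel (edge_vector vs j) (edge_vector vs (Suc j)))"

definition polygonal_region :: "(real \<times> real) list \<Rightarrow> (real \<times> real) set" where
  "polygonal_region vs = inside (\<Union>j < length vs. edge vs j)"

definition axis_parallel :: "(real \<times> real) list \<Rightarrow> bool" where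
  "axis_parallel vs \<longleftrightarrow>
     (\<forall>j < length vs. parallel (edge_vector vs j) (1, 0) \<or> parallel (edge_vector vs j) (0, 1))"

definition unit_square :: "(real \<times> real) set" where
  "unit_square = {0..<1} \<times> {0..<1}"

definition axis_parallel_regions :: "nat \<Rightarrow> (real \<times> real) set set" where
  "axis_parallel_regions N =
     {P. P \<subseteq> unit_square \<and>
         (\<exists>vs. simple_polygon vs \<and> axis_parallel vs \<and> length vs \<le> N \<and>
               set vs \<subseteq> unit_square \<and> P = polygonal_region vs)}"

definition fourier :: "(real \<times> real \<Rightarrow> complex) \<Rightarrow> real \<times> real \<Rightarrow> complex" where
  "fourier g t = (LINT x|lborel. g x * exp (- 2 * complex_of_real pi * \<i> * complex_of_real (x \<bullet> t)))"

definition freq_set :: "nat \<Rightarrow> (int \<times> int) set" where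
  "freq_set N = (\<Union>r\<in>{1..N}. {0..2 * \<lfloor>real (2 * N) / real r\<rfloor>} \<times> {0..2 * int r})"

end

theory Submission
  imports Defs
begin

text \<open>
  Let the coordinates of all vertices of \<open>P\<close> and \<open>Q\<close> span a finite grid. The indicator of \<open>P\<close> is
  constant on the open cells of the grid, hence it is determined by its mixed second differences
  at the grid points, and these vanish except at the vertices. Up to the factor
  \<open>(2 \<pi> \<i>)\<^sup>2 k l\<close>, the Fourier coefficient at \<open>(k, l)\<close> is the exponential sum of these
  differences. For \<open>P\<close> minus \<open>Q\<close> it has at most \<open>2 N\<close> nodes and vanishes on the frequency
  set, which contains all \<open>(i, j)\<close> with \<open>(i + 1) (j + 1) \<le> 2 N\<close>; such a sum is zero. So \<open>P\<close>
  and \<open>Q\<close> agree off the grid lines. They are then equal, since by the Jordan curve theorem every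
  point that is not in a region is a limit of points outside its boundary curve.
\<close>

section \<open>Sums with few nodes that vanish on a hyperbolic cross\<close>

text \<open>
  The test polynomial is a product of two Lagrange polynomials: one isolates a column with
  the fewest points, the other isolates a point in that column.
\<close>

lemma hyperbolic_cross_separates:
  fixes u :: "'a \<Rightarrow> 'c::field" and v :: "'b \<Rightarrow> 'c" and c :: "'a \<Rightarrow> 'b \<Rightarrow> 'c"
  assumes K: "finite K" and u: "inj_on u (fst ` K)" and v: "inj_on v (snd ` K)"
    and c: "\<And>x y. (x, y) \<in> K \<Longrightarrow> c x y \<noteq> 0"
    and vanish: "\<And>i j. (i + 1) * (j + 1) \<le> card K \<Longrightarrow>
      (\<Sum>(x, y)\<in>K. c x y * (u x ^ i * v y ^ j)) = 0"
  shows "K = {}"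
proof (rule ccontr)
  assume "K \<noteq> {}"
  define X where "X = fst ` K"
  define fib where "fib = (\<lambda>x. {y. (x, y) \<in> K})"
  have X: "finite X" "X \<noteq> {}" using K \<open>K \<noteq> {}\<close> by (auto simp: X_def)
  have fib: "finite (fib x)" for x
    by (rule finite_subset[of _ "snd ` K"]) (force simp: fib_def K)+
  obtain x0 where x0: "x0 \<in> X" and min: "\<And>x. x \<in> X \<Longrightarrow> card (fib x0) \<le> card (fib x)"
    using ex_min_if_finite[of "(\<lambda>x. card (fib x)) ` X"] X by (auto simp: not_less)
  obtain y0 where y0: "y0 \<in> fib x0" using x0 by (auto simp: X_def fib_def)
  \<comment> \<open>Minimality of the column \<open>x0\<close> bounds
    \<open>(degree p + 1) * (degree q + 1)\<close> by \<open>card K\<close>, so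
    \<open>vanish\<close> covers every monomial of the test polynomial.\<close>
  have "card X * card (fib x0) \<le> (\<Sum>x\<in>X. card (fib x))"
    using sum_mono[of X "\<lambda>_. card (fib x0)" "\<lambda>x. card (fib x)"] min by simp
  also have "\<dots> = card (SIGMA x:X. fib x)" using X fib by (subst card_SigmaI) auto
  also have "(SIGMA x:X. fib x) = K" by (force simp: X_def fib_def)
  finally have cardK: "card X * card (fib x0) \<le> card K" .
  define p where "p = (\<Prod>x\<in>X - {x0}. [:- u x, 1:])"
  define q where "q = (\<Prod>y\<in>fib x0 - {y0}. [:- v y, 1:])"
  have degp: "Suc (degree p) = card X"
    using X x0 card_gt_0_iff[of X] unfolding p_def by (subst degree_prod_eq_sum_degree) auto
  have degq: "Suc (degree q) = card (fib x0)"
    using fib[of x0] y0 card_gt_0_iff[of "fib x0"] unfolding q_def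
    by (subst degree_prod_eq_sum_degree) auto
  have p0: "poly p (u x) = 0" if "x \<in> X" "x \<noteq> x0" for x
    using that X unfolding p_def poly_prod by (intro prod_zero) auto
  have q0: "poly q (v y) = 0" if "y \<in> fib x0" "y \<noteq> y0" for y
    using that fib[of x0] unfolding q_def poly_prod by (intro prod_zero) auto
  have p1: "poly p (u x0) \<noteq> 0"
    using X x0 u unfolding p_def poly_prod by (auto simp: X_def inj_on_def)
  have q1: "poly q (v y0) \<noteq> 0"
  proof -
    have "fib x0 \<subseteq> snd ` K" by (force simp: fib_def)
    then have "\<And>y. y \<in> fib x0 - {y0} \<Longrightarrow> v y0 \<noteq> v y"
      using inj_onD[OF v] y0 by blast
    then show ?thesis using fib[of x0] unfolding q_def poly_prod by auto
  qed
  have "(\<Sum>(x, y)\<in>K. c x y * (poly p (u x) * poly q (v y))) =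
      (\<Sum>(x, y)\<in>K. \<Sum>i\<le>degree p. \<Sum>j\<le>degree q.
        coeff p i * coeff q j * (c x y * (u x ^ i * v y ^ j)))"
  proof (intro sum.cong refl, clarify)
    fix x y
    have "c x y * (poly p (u x) * poly q (v y)) = (\<Sum>i\<le>degree p. \<Sum>j\<le>degree q.
        c x y * ((coeff p i * u x ^ i) * (coeff q j * v y ^ j)))"
      unfolding poly_altdef sum_product unfolding sum_distrib_left ..
    also have "\<dots> = (\<Sum>i\<le>degree p. \<Sum>j\<le>degree q.
        coeff p i * coeff q j * (c x y * (u x ^ i * v y ^ j)))"
      by (intro sum.cong refl) (simp only: mult_ac)
    finally show "c x y * (poly p (u x) * poly q (v y)) = \<dots>" .
  qed
  also have "\<dots> = (\<Sum>i\<le>degree p. \<Sum>j\<le>degree q. coeff p i * coeff q j *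
      (\<Sum>(x, y)\<in>K. c x y * (u x ^ i * v y ^ j)))"
    unfolding sum_distrib_left case_prod_unfold
    by (subst sum.swap, rule sum.cong[OF refl], subst sum.swap, rule refl)
  also have "\<dots> = 0"
  proof (intro sum.neutral ballI)
    fix i j assume "i \<in> {..degree p}" "j \<in> {..degree q}"
    then have "(i + 1) * (j + 1) \<le> card X * card (fib x0)"
      using degp degq by (intro mult_mono) auto
    then show "coeff p i * coeff q j * (\<Sum>(x, y)\<in>K. c x y * (u x ^ i * v y ^ j)) = 0"
      using vanish cardK by simp
  qed
  finally have "(\<Sum>(x, y)\<in>K. c x y * (poly p (u x) * poly q (v y))) = 0" .
  \<comment> \<open>\<open>p\<close> removes the other columns and \<open>q\<close> the other points
    of the column \<open>x0\<close>; a single nonzero term is left.\<close>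
  moreover have "(\<Sum>(x, y)\<in>K. c x y * (poly p (u x) * poly q (v y)))
      = (\<Sum>(x, y)\<in>{(x0, y0)}. c x y * (poly p (u x) * poly q (v y)))"
  proof (rule sum.mono_neutral_right)
    show "{(x0, y0)} \<subseteq> K" using y0 by (auto simp: fib_def)
    show "\<forall>k\<in>K - {(x0, y0)}. (case k of (x, y) \<Rightarrow> c x y * (poly p (u x) * poly q (v y))) = 0"
    proof (clarify, goal_cases)
      case (1 x y)
      have "x \<in> X" using 1(1) by (force simp: X_def)
      then show ?case using 1 p0[of x] q0[of y] by (cases "x = x0") (auto simp: fib_def)
    qed
  qed (use K in auto)
  ultimately show False using p1 q1 c[of x0 y0] y0 by (auto simp: fib_def)
qed

section \<open>Step functions on a grid\<close>

text \<open>Telescoping from the far left, where \<open>g\<close> is zero. Since \<open>e\<close> is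
  smaller than every gap, \<open>g (a - e)\<close> and \<open>g (a + e)\<close> are the values of
  \<open>g\<close> on the two cells adjoining \<open>a\<close>.\<close>

lemma step_function_expansion:
  fixes g :: "real \<Rightarrow> 'b::ab_group_add"
  assumes X: "finite X" and e: "e > 0"
    and gap: "\<And>a a'. a \<in> X \<Longrightarrow> a' \<in> X \<Longrightarrow> a < a' \<Longrightarrow> a + e < a'"
    and cell: "\<And>x x'. x \<notin> X \<Longrightarrow> x' \<notin> X \<Longrightarrow> (\<And>a. a \<in> X \<Longrightarrow> a < x \<longleftrightarrow> a < x') \<Longrightarrow> g x = g x'"
    and zero: "\<And>x. x \<notin> X \<Longrightarrow> (\<And>a. a \<in> X \<Longrightarrow> x < a) \<Longrightarrow> g x = 0"
    and x: "x \<notin> X"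
  shows "g x = (\<Sum>a | a \<in> X \<and> a < x. g (a + e) - g (a - e))"
  using x
proof (induction "card {a \<in> X. a < x}" arbitrary: x rule: less_induct)
  case less
  let ?A = "{a \<in> X. a < x}"
  have fin: "finite ?A" using X by simp
  show ?case
  proof (cases "?A = {}")
    case True
    then have "\<And>a. a \<in> X \<Longrightarrow> x < a" using less.prems by (force simp: not_less_iff_gr_or_eq)
    then have "g x = 0" by (rule zero[OF less.prems])
    then show ?thesis unfolding True by simp
  next
    case False
    \<comment> \<open>\<open>x\<close> lies in the cell just right of \<open>m\<close>, and
      \<open>m - e\<close> in the cell just left of it, which has one node fewer before it.\<close>
    define m where "m = Max ?A"
    have m: "m \<in> X" "m < x" using Max_in[OF fin False] by (auto simp: m_def)
    have max: "a \<le> m" if "a \<in> X" "a < x" for a using that fin by (auto simp: m_def)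
    have off: "m + e \<notin> X" "m - e \<notin> X" using gap[of m "m + e"] gap[of "m - e" m] m e by auto
    have gx: "g x = g (m + e)"
      using less.prems off(1)
    proof (rule cell)
      fix a assume a: "a \<in> X"
      show "a < x \<longleftrightarrow> a < m + e"
        using max[OF a] gap[of m a] m a e by force
    qed
    have A': "{a \<in> X. a < m - e} = ?A - {m}"
    proof (intro equalityI subsetI)
      fix a assume "a \<in> ?A - {m}"
      then show "a \<in> {a \<in> X. a < m - e}" using max[of a] gap[of a m] m by force
    qed (use m e in auto)
    have "card {a \<in> X. a < m - e} < card ?A"
      unfolding A' using m fin by (intro psubset_card_mono) auto
    from less.hyps[OF this off(2)]
    have "g (m - e) = (\<Sum>a\<in>?A - {m}. g (a + e) - g (a - e))" unfolding A' .
    then show ?thesis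
      using gx sum.remove[of ?A m "\<lambda>a. g (a + e) - g (a - e)"] fin m by simp
  qed
qed

text \<open>
  For \<open>e\<close> smaller than the gaps of the grid, this is the mass at \<open>(a, b)\<close> of the distribution
  \<open>\<partial>\<^sub>x \<partial>\<^sub>y f\<close>.
\<close>

definition jump :: "(real \<times> real \<Rightarrow> complex) \<Rightarrow> real \<Rightarrow> real \<Rightarrow> real \<Rightarrow> complex" where
  "jump f e a b = f (a + e, b + e) - f (a - e, b + e) - (f (a + e, b - e) - f (a - e, b - e))"

text \<open>The indicators of \<open>P\<close> and \<open>Q\<close> will be two instances over the
  same grid. An open cell is described by the nodes to its left and below it, which includes the
  unbounded outer cells.\<close>

locale grid_step_function =
  fixes X Y :: "real set" and e :: real and f :: "real \<times> real \<Rightarrow> complex"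
  assumes X: "finite X" "X \<subseteq> {0..<1}" and Y: "finite Y" "Y \<subseteq> {0..<1}" and e: "e > 0"
    and gapX: "\<And>a a'. a \<in> X \<Longrightarrow> a' \<in> X \<Longrightarrow> a < a' \<Longrightarrow> a + e < a'"
    and gapY: "\<And>b b'. b \<in> Y \<Longrightarrow> b' \<in> Y \<Longrightarrow> b < b' \<Longrightarrow> b + e < b'"
    and cell: "\<And>x x' y y'. x \<notin> X \<Longrightarrow> x' \<notin> X \<Longrightarrow> y \<notin> Y \<Longrightarrow> y' \<notin> Y \<Longrightarrow>
      (\<And>a. a \<in> X \<Longrightarrow> a < x \<longleftrightarrow> a < x') \<Longrightarrow> (\<And>b. b \<in> Y \<Longrightarrow> b < y \<longleftrightarrow> b < y') \<Longrightarrow>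
      f (x, y) = f (x', y')"
    and support: "\<And>p. p \<notin> unit_square \<Longrightarrow> f p = 0"
    and measurable: "f \<in> borel_measurable lborel"
begin

lemma off_X: "a \<in> X \<Longrightarrow> a + e \<notin> X" "a \<in> X \<Longrightarrow> a - e \<notin> X"
  using gapX[of a "a + e"] gapX[of "a - e" a] e by auto

lemma off_Y: "b \<in> Y \<Longrightarrow> b + e \<notin> Y" "b \<in> Y \<Longrightarrow> b - e \<notin> Y"
  using gapY[of b "b + e"] gapY[of "b - e" b] e by auto

lemma left:
  assumes "x \<notin> X" "y \<notin> Y" "\<And>a. a \<in> X \<Longrightarrow> x < a"
  shows "f (x, y) = 0"
proof -
  have ge: "0 \<le> a" if "a \<in> X" for a using X(2) that by auto
  \<comment> \<open>Like \<open>x\<close>, the abscissa \<open>-1\<close> lies left of all nodes,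
    but it is outside the unit square.\<close>
  have "f (x, y) = f (-1, y)"
  proof (rule cell)
    show "x \<notin> X" "y \<notin> Y" "y \<notin> Y" by fact+
    show "- 1 \<notin> X" using ge[of "-1"] by auto
    show "a < x \<longleftrightarrow> a < - 1" if "a \<in> X" for a using ge[OF that] assms(3)[OF that] by simp
  qed simp
  then show ?thesis using support[of "(-1, y)"] by (simp add: unit_square_def)
qed

lemma below:
  assumes "x \<notin> X" "y \<notin> Y" "\<And>b. b \<in> Y \<Longrightarrow> y < b"
  shows "f (x, y) = 0"
proof -
  have ge: "0 \<le> b" if "b \<in> Y" for b using Y(2) that by auto
  have "f (x, y) = f (x, -1)"
    using assms(1,1,2)
  proof (rule cell)
    show "- 1 \<notin> Y" using ge[of "-1"] by auto
    show "b < y \<longleftrightarrow> b < - 1" if "b \<in> Y" for b using ge[OF that] assms(3)[OF that] by simp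
  qed simp
  then show ?thesis using support[of "(x, -1)"] by (simp add: unit_square_def)
qed

lemma expansion_fst:
  assumes "x \<notin> X" "y \<notin> Y"
  shows "f (x, y) = (\<Sum>a | a \<in> X \<and> a < x. f (a + e, y) - f (a - e, y))"
proof (rule step_function_expansion[where g = "\<lambda>x. f (x, y)"])
  show "f (x, y) = f (x', y)" if "x \<notin> X" "x' \<notin> X" "\<And>a. a \<in> X \<Longrightarrow> a < x \<longleftrightarrow> a < x'" for x x'
    by (rule cell[OF that(1,2) assms(2,2) that(3) refl])
  show "f (x, y) = 0" if "x \<notin> X" "\<And>a. a \<in> X \<Longrightarrow> x < a" for x
    using that(1) assms(2) that(2) by (rule left)
qed (rule X e assms | erule (2) gapX)+

text \<open>The column difference at \<open>a\<close> is itself a step function of \<open>y\<close>,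
  and its jumps are the mixed differences.\<close>

lemma expansion_snd:
  assumes "a \<in> X" "y \<notin> Y"
  shows "f (a + e, y) - f (a - e, y) = (\<Sum>b | b \<in> Y \<and> b < y. jump f e a b)"
  unfolding jump_def
proof (rule step_function_expansion[where g = "\<lambda>y. f (a + e, y) - f (a - e, y)"])
  note off = off_X[OF assms(1)]
  fix y y' assume y: "y \<notin> Y" "y' \<notin> Y" "\<And>b. b \<in> Y \<Longrightarrow> b < y \<longleftrightarrow> b < y'"
  have "f (x, y) = f (x, y')" if "x \<notin> X" for x
    by (rule cell[OF that that y(1,2) refl y(3)])
  from this[OF off(1)] this[OF off(2)]
  show "f (a + e, y) - f (a - e, y) = f (a + e, y') - f (a - e, y')" by simp
next
  note off = off_X[OF assms(1)]
  fix y assume y: "y \<notin> Y" "\<And>b. b \<in> Y \<Longrightarrow> y < b"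
  show "f (a + e, y) - f (a - e, y) = 0"
    using below[OF off(1) y] below[OF off(2) y] by simp
qed (rule Y e assms | erule (2) gapY)+

lemma expansion:
  assumes "x \<notin> X" "y \<notin> Y"
  shows "f (x, y) = (\<Sum>a | a \<in> X \<and> a < x. \<Sum>b | b \<in> Y \<and> b < y. jump f e a b)"
  unfolding expansion_fst[OF assms] by (rule sum.cong) (use expansion_snd assms(2) in auto)

text \<open>At \<open>y = 1\<close> all nodes have been passed and the half-open square has been
  left. Together with \<open>sum_jump_fst\<close> this cancels the boundary terms in
  \<open>fourier_jump\<close>.\<close>

lemma sum_jump_snd: "a \<in> X \<Longrightarrow> (\<Sum>b\<in>Y. jump f e a b) = 0"
proof -
  assume a: "a \<in> X"
  have "1 \<notin> Y" "{b. b \<in> Y \<and> b < 1} = Y" using Y(2) by auto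
  then show ?thesis using expansion_snd[OF a, of 1] support by (simp add: unit_square_def)
qed

lemma sum_jump_fst: "b \<in> Y \<Longrightarrow> (\<Sum>a\<in>X. jump f e a b) = 0"
proof -
  assume b: "b \<in> Y"
  have "1 \<notin> X" "{a. a \<in> X \<and> a < 1} = X" using X(2) by auto
  then have "(\<Sum>a\<in>X. f (a + e, y) - f (a - e, y)) = 0" if "y \<notin> Y" for y
    using expansion_fst[of 1 y] support that by (simp add: unit_square_def)
  from this[of "b + e"] this[of "b - e"] show ?thesis
    using off_Y[OF b] by (simp add: jump_def sum_subtractf)
qed

end

section \<open>Fourier coefficients of a step function\<close>

lemma integral_lborel_product:
  fixes g h :: "real \<Rightarrow> complex"
  assumes g: "integrable lborel g" and h: "integrable lborel h"
  shows "integrable lborel (\<lambda>p. g (fst p) * h (snd p))"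
    and "(LINT p|lborel. g (fst p) * h (snd p)) = (LINT x|lborel. g x) * (LINT y|lborel. h y)"
proof -
  have m: "g \<in> borel_measurable lborel" "h \<in> borel_measurable lborel"
    using g h by (simp_all add: borel_measurable_integrable)
  have int: "integrable (lborel \<Otimes>\<^sub>M lborel) (\<lambda>p. g (fst p) * h (snd p))"
  proof (rule lborel_pair.Fubini_integrable)
    show "(\<lambda>p. g (fst p) * h (snd p)) \<in> borel_measurable (lborel \<Otimes>\<^sub>M lborel)"
      using m by measurable
    show "integrable lborel (\<lambda>x. LINT y|lborel. norm (g (fst (x, y)) * h (snd (x, y))))"
      using g by (simp add: norm_mult)
  qed (use h in simp)
  then show "integrable lborel (\<lambda>p. g (fst p) * h (snd p))" by (simp add: lborel_prod)
  show "(LINT p|lborel. g (fst p) * h (snd p)) = (LINT x|lborel. g x) * (LINT y|lborel. h y)"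
    using lborel_pair.integral_fst'[OF int] by (simp add: lborel_prod)
qed

text \<open>The one-dimensional character with the sign used in \<open>fourier\<close>. The values
  of \<open>wave 1\<close> at the grid coordinates become the nodes of the exponential sum.\<close>

definition wave :: "nat \<Rightarrow> real \<Rightarrow> complex" where
  "wave k x = exp (- (2 * complex_of_real pi * \<i> * of_nat k * complex_of_real x))"

lemma wave_power: "wave k x = wave 1 x ^ k"
  by (simp add: wave_def mult_ac flip: exp_of_nat_mult)

lemma wave_1_right: "wave k 1 = 1"
  using exp_integer_2pi[of "of_int (- int k)"] by (simp add: wave_def mult_ac)

text \<open>Arguments with the same value differ by an integer, and the interval is half-open of
  length 1.\<close>

lemma inj_on_wave: "inj_on (wave 1) {0..<1}"
proof (rule inj_onI)
  fix x y :: real assume xy: "x \<in> {0..<1}" "y \<in> {0..<1}" and "wave 1 x = wave 1 y"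
  then obtain n :: int where "- (2 * complex_of_real pi * \<i> * of_real x) =
      - (2 * complex_of_real pi * \<i> * of_real y) + of_int (2 * n) * pi * \<i>"
    by (auto simp: wave_def exp_eq)
  from arg_cong[OF this, of Im] have "2 * pi * (y - x) = 2 * pi * of_int n"
    by (simp add: algebra_simps)
  then have n: "y - x = of_int n" unfolding mult_cancel_left using pi_neq_zero by simp
  moreover have "n = 0"
  proof -
    have "-1 < real_of_int n" "real_of_int n < 1" using xy unfolding n[symmetric] by auto
    then show ?thesis by linarith
  qed
  ultimately show "x = y" by simp
qed

text \<open>A primitive of \<open>2 * pi * \<i> * k * wave k\<close> is \<open>- wave k\<close>.
  Keeping the factor on the left instead of dividing by it includes \<open>k = 0\<close>.\<close>

lemma integral_wave:
  assumes "a \<le> 1"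
  shows "integrable lborel (\<lambda>x. indicator {a..1} x * wave k x)"
    and "2 * complex_of_real pi * \<i> * of_nat k * (LINT x|lborel. indicator {a..1} x * wave k x)
      = wave 1 a ^ k - 1"
proof -
  let ?c = "2 * complex_of_real pi * \<i> * of_nat k"
  have cont: "continuous_on A (wave k)" for A
    unfolding wave_def by (intro continuous_intros)
  have "set_integrable lborel {a..1} (wave k)"
    using borel_integrable_atLeastAtMost' cont by blast
  then show "integrable lborel (\<lambda>x. indicator {a..1} x * wave k x)"
    unfolding set_integrable_def
    by (rule back_subst[where P = "integrable lborel"]) (auto simp: indicator_def)
  have "(LINT x|lborel. indicator {a..1} x *\<^sub>R (?c * wave k x)) = - wave k 1 - - wave k a"
  proof (rule integral_FTC_atLeastAtMost[OF assms])
    show "((\<lambda>x. - wave k x) has_vector_derivative ?c * wave k x) (at x within {a..1})" for x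
      unfolding wave_def
      by (auto intro!: derivative_eq_intros has_vector_derivative_real_field
          simp: mult_ac)
    show "continuous_on {a..1} (\<lambda>x. ?c * wave k x)"
      by (intro continuous_intros cont)
  qed
  also have "(\<lambda>x. indicator {a..1} x *\<^sub>R (?c * wave k x)) =
      (\<lambda>x. ?c * (indicator {a..1} x * wave k x))"
    by (auto simp: indicator_def)
  finally show "?c * (LINT x|lborel. indicator {a..1} x * wave k x) = wave 1 a ^ k - 1"
    using wave_1_right[of k] wave_power[of k a] by simp
qed

lemma AE_off_grid:
  assumes "finite X" "finite Y"
  shows "AE p in lborel. (fst p :: real) \<notin> X \<and> (snd p :: real) \<notin> Y"
proof -
  have X: "AE x in lborel. x \<notin> X" "AE x in lborel. x \<notin> Y"
    using assms by (auto intro!: AE_not_in finite_imp_null_set_lborel)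
  have [measurable]: "X \<in> sets borel" "Y \<in> sets borel"
    using assms by (auto intro: borel_closed finite_imp_closed)
  have "AE p in lborel \<Otimes>\<^sub>M lborel. fst p \<notin> X \<and> snd p \<notin> Y"
  proof (rule lborel_pair.AE_pair_measure)
    show "{p \<in> space (lborel \<Otimes>\<^sub>M lborel). fst p \<notin> X \<and> snd p \<notin> Y} \<in> sets (lborel \<Otimes>\<^sub>M lborel)"
      by measurable
  qed (use X in auto)
  then show ?thesis unfolding lborel_prod .
qed

context grid_step_function
begin

text \<open>\<open>expansion\<close> writes \<open>f\<close> as a sum of quadrants. As
  \<open>f\<close> vanishes beyond 1, they may be cut off there, which makes each summand
  integrable. Grid lines are null sets, so strict and weak inequalities agree almost
  everywhere.\<close>

lemma AE_expansion:
  "AE p in lborel. f p =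
    (\<Sum>a\<in>X. \<Sum>b\<in>Y. jump f e a b * (indicator {a..1} (fst p) * indicator {b..1} (snd p)))"
  using AE_off_grid[OF X(1) Y(1)]
proof eventually_elim
  case (elim p)
  obtain x y where p: "p = (x, y)" by (cases p)
  have xy: "x \<notin> X" "y \<notin> Y" using elim p by auto
  show ?case
  proof (cases "x \<le> 1 \<and> y \<le> 1")
    case True
    have "f p = (\<Sum>a\<in>X. if a < x then \<Sum>b\<in>Y. if b < y then jump f e a b else 0 else 0)"
      unfolding p expansion[OF xy] using X(1) Y(1) by (simp add: sum.inter_filter)
    also have "\<dots> = (\<Sum>a\<in>X. \<Sum>b\<in>Y. jump f e a b * (indicator {a..1} x * indicator {b..1} y))"
      using xy True by (intro sum.cong refl) (auto simp: indicator_def intro!: sum.cong)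
    finally show ?thesis by (simp add: p)
  next
    case False
    then have "f p = 0" by (intro support) (auto simp: p unit_square_def)
    then show ?thesis using False by (auto simp: p indicator_def)
  qed
qed

text \<open>The expansion is integrated term by term. For \<open>k = 0\<close> or
  \<open>l = 0\<close> the identity says that the sum on the right vanishes, whatever the
  coefficient of \<open>f\<close> is.\<close>

lemma fourier_jump:
  "(2 * complex_of_real pi * \<i> * of_nat k) * (2 * complex_of_real pi * \<i> * of_nat l) *
      fourier f (real k, real l) =
    (\<Sum>a\<in>X. \<Sum>b\<in>Y. jump f e a b * (wave 1 a ^ k * wave 1 b ^ l))"
proof -
  define c where "c = (\<lambda>k. 2 * complex_of_real pi * \<i> * of_nat k)"
  define I where "I = (\<lambda>k a. LINT x|lborel. indicator {a..1} x * wave k x)"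
  let ?g = "\<lambda>k (a::real) x. indicator {a..1} x * wave k x"
  have le: "a \<in> X \<Longrightarrow> a \<le> 1" "b \<in> Y \<Longrightarrow> b \<le> 1" for a b using X(2) Y(2) by force+
  have exp: "exp (- 2 * complex_of_real pi * \<i> * complex_of_real (p \<bullet> (real k, real l))) =
      wave k (fst p) * wave l (snd p)" for p
    by (simp add: wave_def inner_prod_def algebra_simps flip: exp_add)
  have "fourier f (real k, real l) = (LINT p|lborel. (\<Sum>a\<in>X. \<Sum>b\<in>Y.
      jump f e a b * (?g k a (fst p) * ?g l b (snd p))))"
    unfolding fourier_def exp
  proof (rule integral_cong_AE)
    show "AE p in lborel. f p * (wave k (fst p) * wave l (snd p)) =
        (\<Sum>a\<in>X. \<Sum>b\<in>Y. jump f e a b * (?g k a (fst p) * ?g l b (snd p)))"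
      using AE_expansion
      by eventually_elim (simp add: sum_distrib_left sum_distrib_right mult_ac)
    have "continuous_on UNIV (\<lambda>p. wave k (fst p) * wave l (snd p))"
      unfolding wave_def by (intro continuous_intros)
    then have "(\<lambda>p. wave k (fst p) * wave l (snd p)) \<in> borel_measurable lborel"
      by (simp add: borel_measurable_continuous_onI)
    with measurable
    show "(\<lambda>p. f p * (wave k (fst p) * wave l (snd p))) \<in> borel_measurable lborel"
      by (rule borel_measurable_times)
    show "(\<lambda>p. \<Sum>a\<in>X. \<Sum>b\<in>Y. jump f e a b * (?g k a (fst p) * ?g l b (snd p)))
        \<in> borel_measurable lborel"
      using le by (intro borel_measurable_sum borel_measurable_times borel_measurable_const
        borel_measurable_integrable integral_lborel_product integral_wave) auto
  qed
  also have "\<dots> = (\<Sum>a\<in>X. \<Sum>b\<in>Y. jump f e a b * (I k a * I l b))"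
  proof -
    have *: "integrable lborel (\<lambda>p. jump f e a b * (?g k a (fst p) * ?g l b (snd p)))"
      "(LINT p|lborel. jump f e a b * (?g k a (fst p) * ?g l b (snd p))) =
        jump f e a b * (I k a * I l b)" if "a \<in> X" "b \<in> Y" for a b
      using integral_lborel_product[OF integral_wave(1) integral_wave(1)] le that
      unfolding I_def by simp_all
    have "(LINT p|lborel. (\<Sum>a\<in>X. \<Sum>b\<in>Y. jump f e a b * (?g k a (fst p) * ?g l b (snd p)))) =
        (\<Sum>a\<in>X. LINT p|lborel. (\<Sum>b\<in>Y. jump f e a b * (?g k a (fst p) * ?g l b (snd p))))"
      by (intro Bochner_Integration.integral_sum Bochner_Integration.integrable_sum *(1))
    also have "\<dots> = (\<Sum>a\<in>X. \<Sum>b\<in>Y. LINT p|lborel.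
        jump f e a b * (?g k a (fst p) * ?g l b (snd p)))"
      by (intro sum.cong refl Bochner_Integration.integral_sum *(1))
    also have "\<dots> = (\<Sum>a\<in>X. \<Sum>b\<in>Y. jump f e a b * (I k a * I l b))"
      by (intro sum.cong refl *(2))
    finally show ?thesis .
  qed
  finally have "c k * c l * fourier f (real k, real l) =
      (\<Sum>a\<in>X. \<Sum>b\<in>Y. jump f e a b * ((c k * I k a) * (c l * I l b)))"
    by (simp add: sum_distrib_left mult_ac)
  also have "\<dots> = (\<Sum>a\<in>X. \<Sum>b\<in>Y. jump f e a b * ((wave 1 a ^ k - 1) * (wave 1 b ^ l - 1)))"
    unfolding I_def c_def using integral_wave(2) le by (intro sum.cong refl) simp
  \<comment> \<open>From \<open>(u - 1) * (v - 1) = u * v - (u - 1) - v\<close>; the last two parts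
    vanish by \<open>sum_jump_snd\<close> and \<open>sum_jump_fst\<close>.\<close>
  also have "\<dots> = (\<Sum>a\<in>X. \<Sum>b\<in>Y. jump f e a b * (wave 1 a ^ k * wave 1 b ^ l))
      - (\<Sum>a\<in>X. (wave 1 a ^ k - 1) * (\<Sum>b\<in>Y. jump f e a b))
      - (\<Sum>b\<in>Y. wave 1 b ^ l * (\<Sum>a\<in>X. jump f e a b))"
    unfolding sum_distrib_left
    by (subst (3) sum.swap) (simp add: algebra_simps sum.distrib sum_subtractf)
  finally have "c k * c l * fourier f (real k, real l) =
      (\<Sum>a\<in>X. \<Sum>b\<in>Y. jump f e a b * (wave 1 a ^ k * wave 1 b ^ l))"
    by (simp add: sum_jump_fst sum_jump_snd)
  then show ?thesis unfolding c_def .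
qed

end

section \<open>Regions bounded by axis-parallel polygons\<close>

lemma inside_iff_segment:
  fixes p q :: "'a::real_normed_vector"
  assumes "closed_segment p q \<inter> S = {}"
  shows "p \<in> inside S \<longleftrightarrow> q \<in> inside S"
proof -
  have "connected_component (- S) p q"
    unfolding connected_component_def using assms
    by (intro exI[of _ "closed_segment p q"]) (auto intro: convex_connected)
  then show ?thesis
    using inside_same_component connected_component_sym by metis
qed

lemma closed_segment_fst_snd:
  assumes "p \<in> closed_segment q r"
  shows "fst p \<in> closed_segment (fst q) (fst r)" "snd p \<in> closed_segment (snd q) (snd r)"
  using assms by (auto simp: in_segment)

text \<open>The grid may have more coordinates than the vertices of \<open>vs\<close>, so that two
  polygons can share it.\<close>

locale polygon_grid =
  fixes vs :: "(real \<times> real) list" and X Y :: "real set" and e :: real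
  assumes simple: "simple_polygon vs" and axis: "axis_parallel vs"
    and vs: "set vs \<subseteq> X \<times> Y" and region: "polygonal_region vs \<subseteq> unit_square"
    and X: "finite X" "X \<subseteq> {0..<1}" and Y: "finite Y" "Y \<subseteq> {0..<1}" and e: "e > 0"
    and gapX: "\<And>a a'. a \<in> X \<Longrightarrow> a' \<in> X \<Longrightarrow> a < a' \<Longrightarrow> a + e < a'"
    and gapY: "\<And>b b'. b \<in> Y \<Longrightarrow> b' \<in> Y \<Longrightarrow> b < b' \<Longrightarrow> b + e < b'"
begin

definition "curve = (\<Union>j<length vs. edge vs j)"

lemma vertex_in: "vertex vs j \<in> set vs"
proof -
  have "vs \<noteq> []" using simple by (auto simp: simple_polygon_def)
  then show ?thesis by (simp add: vertex_def)
qed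

text \<open>A horizontal edge lies at the height of its endpoints, which is in \<open>Y\<close>; so
  only a vertical edge can carry such a point.\<close>

lemma off_vertical:
  assumes "p \<in> curve" "snd p \<notin> Y"
  shows "\<exists>j<length vs. edge_vector vs j \<in> {0} \<times> UNIV \<and> p \<in> edge vs j \<and> fst p \<in> X"
proof -
  obtain j where j: "j < length vs" "p \<in> edge vs j" using assms(1) by (auto simp: curve_def)
  have v: "vertex vs j \<in> X \<times> Y" "vertex vs (Suc j) \<in> X \<times> Y" using vs vertex_in by blast+
  note p = closed_segment_fst_snd[OF j(2)[unfolded edge_def]]
  have "\<not> parallel (edge_vector vs j) (1, 0)"
  proof
    assume "parallel (edge_vector vs j) (1, 0)"
    then have "snd (vertex vs (Suc j)) = snd (vertex vs j)"
      by (auto simp: parallel_def edge_vector_def prod_eq_iff)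
    then show False using p(2) v assms(2) by (auto simp: mem_Times_iff)
  qed
  then have "parallel (edge_vector vs j) (0, 1)"
    using axis j(1) by (auto simp: axis_parallel_def)
  then have x: "fst (vertex vs (Suc j)) = fst (vertex vs j)"
    by (auto simp: parallel_def edge_vector_def prod_eq_iff)
  then have "edge_vector vs j \<in> {0} \<times> UNIV" by (simp add: edge_vector_def mem_Times_iff)
  moreover have "fst p \<in> X" using p(1) x v by (auto simp: mem_Times_iff)
  ultimately show ?thesis using j by (intro exI[of _ j] conjI)
qed

lemma off_horizontal:
  assumes "p \<in> curve" "fst p \<notin> X"
  shows "\<exists>j<length vs. edge_vector vs j \<in> UNIV \<times> {0} \<and> p \<in> edge vs j \<and> snd p \<in> Y"
proof -
  obtain j where j: "j < length vs" "p \<in> edge vs j" using assms(1) by (auto simp: curve_def)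
  have v: "vertex vs j \<in> X \<times> Y" "vertex vs (Suc j) \<in> X \<times> Y" using vs vertex_in by blast+
  note p = closed_segment_fst_snd[OF j(2)[unfolded edge_def]]
  have "\<not> parallel (edge_vector vs j) (0, 1)"
  proof
    assume "parallel (edge_vector vs j) (0, 1)"
    then have "fst (vertex vs (Suc j)) = fst (vertex vs j)"
      by (auto simp: parallel_def edge_vector_def prod_eq_iff)
    then show False using p(1) v assms(2) by (auto simp: mem_Times_iff)
  qed
  then have "parallel (edge_vector vs j) (1, 0)"
    using axis j(1) by (auto simp: axis_parallel_def)
  then have y: "snd (vertex vs (Suc j)) = snd (vertex vs j)"
    by (auto simp: parallel_def edge_vector_def prod_eq_iff)
  then have "edge_vector vs j \<in> UNIV \<times> {0}" by (simp add: edge_vector_def mem_Times_iff)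
  moreover have "snd p \<in> Y" using p(2) y v by (auto simp: mem_Times_iff)
  ultimately show ?thesis using j by (intro exI[of _ j] conjI)
qed

text \<open>No point of \<open>Z\<close> lies strictly between \<open>b\<close> and
  \<open>c\<close>, so a segment with ends in \<open>Z\<close> that reaches \<open>c\<close> extends
  to \<open>b\<close>.\<close>

lemma gap_between:
  assumes "y1 \<in> Z" "y2 \<in> Z" "b \<in> Z" "c \<in> {b - e, b + e}" "c \<in> closed_segment y1 y2"
    and gap: "\<And>b b'. b \<in> Z \<Longrightarrow> b' \<in> Z \<Longrightarrow> b < b' \<Longrightarrow> b + e < b'"
  shows "b \<in> closed_segment y1 y2"
proof -
  have "z \<le> b" if "z \<in> Z" "z \<le> c" for z
    using that gap[OF assms(3) that(1)] assms(4) e by fastforce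
  moreover have "b \<le> z" if "z \<in> Z" "c \<le> z" for z
    using that gap[OF that(1) assms(3)] assms(4) e by fastforce
  ultimately show ?thesis
    using assms(1,2,5) by (simp add: closed_segment_eq_real_ivl split: if_splits)
qed

lemma vertical_through:
  assumes ab: "a \<in> X" "b \<in> Y" and c: "c \<in> {b - e, b + e}" and p: "(a, c) \<in> curve"
  shows "\<exists>j<length vs. edge_vector vs j \<in> {0} \<times> UNIV \<and> (a, b) \<in> edge vs j"
proof -
  have "c \<notin> Y" using gapY[of b "b + e"] gapY[of "b - e" b] e ab c by auto
  then obtain j where j: "j < length vs" "edge_vector vs j \<in> {0} \<times> UNIV" "(a, c) \<in> edge vs j"
    using off_vertical[OF p] by auto
  obtain x1 y1 x2 y2 where v: "vertex vs j = (x1, y1)" "vertex vs (Suc j) = (x2, y2)"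
    by (meson surj_pair)
  have "y1 \<in> Y" "y2 \<in> Y" using vertex_in[of j] vertex_in[of "Suc j"] vs v by auto
  have x: "x2 = x1" using j(2) v by (simp add: edge_vector_def)
  have "b \<in> closed_segment y1 y2"
    using \<open>y1 \<in> Y\<close> \<open>y2 \<in> Y\<close> ab(2) c _ gapY
  proof (rule gap_between)
    show "c \<in> closed_segment y1 y2"
      using closed_segment_fst_snd(2)[OF j(3)[unfolded edge_def]] v by simp
  qed
  moreover have "a = x1"
    using closed_segment_fst_snd(1)[OF j(3)[unfolded edge_def]] v x by simp
  ultimately have "(a, b) \<in> edge vs j"
    using v x by (auto simp: edge_def in_segment algebra_simps)
  then show ?thesis using j by (intro exI[of _ j] conjI)
qed

lemma horizontal_through:
  assumes ab: "a \<in> X" "b \<in> Y" and c: "c \<in> {a - e, a + e}" and p: "(c, b) \<in> curve"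
  shows "\<exists>j<length vs. edge_vector vs j \<in> UNIV \<times> {0} \<and> (a, b) \<in> edge vs j"
proof -
  have "c \<notin> X" using gapX[of a "a + e"] gapX[of "a - e" a] e ab c by auto
  then obtain j where j: "j < length vs" "edge_vector vs j \<in> UNIV \<times> {0}" "(c, b) \<in> edge vs j"
    using off_horizontal[OF p] by auto
  obtain x1 y1 x2 y2 where v: "vertex vs j = (x1, y1)" "vertex vs (Suc j) = (x2, y2)"
    by (meson surj_pair)
  have "x1 \<in> X" "x2 \<in> X" using vertex_in[of j] vertex_in[of "Suc j"] vs v by auto
  have y: "y2 = y1" using j(2) v by (simp add: edge_vector_def)
  have "a \<in> closed_segment x1 x2"
    using \<open>x1 \<in> X\<close> \<open>x2 \<in> X\<close> ab(1) c _ gapX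
  proof (rule gap_between)
    show "c \<in> closed_segment x1 x2"
      using closed_segment_fst_snd(1)[OF j(3)[unfolded edge_def]] v by simp
  qed
  moreover have "b = y1"
    using closed_segment_fst_snd(2)[OF j(3)[unfolded edge_def]] v y by simp
  ultimately have "(a, b) \<in> edge vs j"
    using v y by (auto simp: edge_def in_segment algebra_simps)
  then show ?thesis using j by (intro exI[of _ j] conjI)
qed

text \<open>Edge vectors are nonzero, so no edge is both vertical and horizontal. The two edges are
  therefore different, and simplicity lets them meet only in a common endpoint.\<close>

lemma crossing_is_vertex:
  assumes "i < length vs" "j < length vs" "p \<in> edge vs i" "p \<in> edge vs j"
    and "edge_vector vs i \<in> {0} \<times> UNIV" "edge_vector vs j \<in> UNIV \<times> {0}"
  shows "p \<in> set vs"
proof -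
  have "i \<noteq> j"
  proof
    assume "i = j"
    then have "edge_vector vs i = 0" using assms(5,6) by (auto simp: zero_prod_def)
    then show False using axis assms(1)
      by (auto simp: axis_parallel_def parallel_def zero_prod_def)
  qed
  then have "edge vs i \<inter> edge vs j
      \<subseteq> {vertex vs i, vertex vs (Suc i)} \<inter> {vertex vs j, vertex vs (Suc j)}"
    using simple assms(1,2) by (simp add: simple_polygon_def)
  then have "p = vertex vs i \<or> p = vertex vs (Suc i)" using assms(3,4) by blast
  then show ?thesis using vertex_in by metis
qed

lemma region_iff:
  "closed_segment p q \<inter> curve = {} \<Longrightarrow> p \<in> polygonal_region vs \<longleftrightarrow> q \<in> polygonal_region vs"
  unfolding polygonal_region_def using inside_iff_segment[of p q curve] by (simp add: curve_def)

lemma near_X: "a \<in> X \<Longrightarrow> x \<in> X \<Longrightarrow> x \<in> closed_segment (a - e) (a + e) \<Longrightarrow> x = a"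
  using gapX[of a x] gapX[of x a] e
  by (cases x a rule: linorder_cases) (auto simp: closed_segment_eq_real_ivl)

lemma near_Y: "b \<in> Y \<Longrightarrow> y \<in> Y \<Longrightarrow> y \<in> closed_segment (b - e) (b + e) \<Longrightarrow> y = b"
  using gapY[of b y] gapY[of y b] e
  by (cases y b rule: linorder_cases) (auto simp: closed_segment_eq_real_ivl)

text \<open>At a height off the grid the curve can meet the short segment only on vertical grid
  lines, and the one at \<open>a\<close> is the only one within reach.\<close>

lemma horizontal_move:
  assumes "a \<in> X" "c \<notin> Y" "(a, c) \<notin> curve"
  shows "(a - e, c) \<in> polygonal_region vs \<longleftrightarrow> (a + e, c) \<in> polygonal_region vs"
proof (rule region_iff, rule ccontr)
  assume "closed_segment (a - e, c) (a + e, c) \<inter> curve \<noteq> {}"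
  then obtain p where p: "p \<in> closed_segment (a - e, c) (a + e, c)" "p \<in> curve" by blast
  note pc = closed_segment_fst_snd[OF p(1)]
  have c: "snd p = c" using pc(2) by simp
  then have "fst p \<in> X" using off_vertical[OF p(2)] assms(2) by blast
  then have "fst p = a" using near_X[OF assms(1)] pc(1) by simp
  then show False using assms(3) p(2) c by (metis prod.collapse)
qed

lemma vertical_move:
  assumes "b \<in> Y" "c \<notin> X" "(c, b) \<notin> curve"
  shows "(c, b - e) \<in> polygonal_region vs \<longleftrightarrow> (c, b + e) \<in> polygonal_region vs"
proof (rule region_iff, rule ccontr)
  assume "closed_segment (c, b - e) (c, b + e) \<inter> curve \<noteq> {}"
  then obtain p where p: "p \<in> closed_segment (c, b - e) (c, b + e)" "p \<in> curve" by blast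
  note pc = closed_segment_fst_snd[OF p(1)]
  have c: "fst p = c" using pc(1) by simp
  then have "snd p \<in> Y" using off_horizontal[OF p(2)] assms(2) by blast
  then have "snd p = b" using near_Y[OF assms(1)] pc(2) by simp
  then show False using assms(3) p(2) c by (metis prod.collapse)
qed

lemma open_region: "open (polygonal_region vs)"
  unfolding polygonal_region_def by (intro open_inside closed_UN) (auto simp: edge_def)

text \<open>The curve lies on the grid lines and open cells are convex, so a segment joining two
  points of a cell avoids the curve and does not change sides.\<close>

sublocale grid_step_function X Y e "indicator (polygonal_region vs)"
proof
  fix x x' y y' assume x: "x \<notin> X" "x' \<notin> X" "\<And>a. a \<in> X \<Longrightarrow> a < x \<longleftrightarrow> a < x'"
    and y: "y \<notin> Y" "y' \<notin> Y" "\<And>b. b \<in> Y \<Longrightarrow> b < y \<longleftrightarrow> b < y'"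
  have "p \<notin> curve" if p: "p \<in> closed_segment (x, y) (x', y')" for p
  proof
    assume "p \<in> curve"
    note pc = closed_segment_fst_snd[OF p, simplified]
    have "fst p \<notin> X"
    proof
      assume a: "fst p \<in> X"
      then have "fst p \<noteq> x" "fst p \<noteq> x'" using x(1,2) by auto
      then show False
        using x(3)[OF a] pc(1) by (auto simp: closed_segment_eq_real_ivl split: if_splits)
    qed
    moreover have "snd p \<notin> Y"
    proof
      assume a: "snd p \<in> Y"
      then have "snd p \<noteq> y" "snd p \<noteq> y'" using y(1,2) by auto
      then show False
        using y(3)[OF a] pc(2) by (auto simp: closed_segment_eq_real_ivl split: if_splits)
    qed
    ultimately show False using off_vertical[OF \<open>p \<in> curve\<close>] by blast
  qed
  then have "closed_segment (x, y) (x', y') \<inter> curve = {}" by blast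
  from region_iff[OF this]
  show "indicator (polygonal_region vs) (x, y) =
      (indicator (polygonal_region vs) (x', y') :: complex)"
    by (simp add: indicator_def)
next
  show "indicator (polygonal_region vs) p = (0 :: complex)" if "p \<notin> unit_square" for p
    using region that by (auto simp: indicator_def)
  show "indicator (polygonal_region vs) \<in> borel_measurable lborel"
    using open_region by (intro borel_measurable_indicator) auto
qed (fact X Y e gapX gapY)+

text \<open>
  At a grid point that is not a vertex, no vertical edge or no horizontal edge passes, so the four
  surrounding quadrants can be joined in pairs without crossing the curve.
\<close>

lemma jump_eq_0:
  assumes "a \<in> X" "b \<in> Y" "(a, b) \<notin> set vs"
  shows "jump (indicator (polygonal_region vs)) e a b = 0"
proof -
  \<comment> \<open>Otherwise a vertical and a horizontal edge both pass through
    \<open>(a, b)\<close>, which is then a vertex.\<close>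
  have "(\<forall>c\<in>{b - e, b + e}. (a, c) \<notin> curve) \<or> (\<forall>c\<in>{a - e, a + e}. (c, b) \<notin> curve)"
    using vertical_through[OF assms(1,2)] horizontal_through[OF assms(1,2)]
      crossing_is_vertex assms(3) by meson
  then show ?thesis
  proof
    assume "\<forall>c\<in>{b - e, b + e}. (a, c) \<notin> curve"
    then show ?thesis
      using horizontal_move[OF assms(1) off_Y(1)[OF assms(2)]]
        horizontal_move[OF assms(1) off_Y(2)[OF assms(2)]]
      by (simp add: jump_def indicator_def)
  next
    assume "\<forall>c\<in>{a - e, a + e}. (c, b) \<notin> curve"
    then show ?thesis
      using vertical_move[OF assms(2) off_X(1)[OF assms(1)]]
        vertical_move[OF assms(2) off_X(2)[OF assms(1)]]
      by (simp add: jump_def indicator_def)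
  qed
qed

end

section \<open>Simple polygons as Jordan curves\<close>

text \<open>Edges are appended one at a time. The bound \<open>m < length vs\<close> leaves out the
  closing edge, with which the path would return to its start and no longer be an arc.\<close>

lemma simple_polygon_arc:
  assumes s: "simple_polygon vs" and m: "0 < m" "m < length vs"
  shows "\<exists>g. arc g \<and> pathstart g = vertex vs 0 \<and> pathfinish g = vertex vs m \<and>
    path_image g = (\<Union>j<m. edge vs j)"
  using m
proof (induction m)
  case (Suc m)
  have v: "vertex vs i = vertex vs j \<longleftrightarrow> i = j" if "i < length vs" "j < length vs" for i j
    using s that by (simp add: simple_polygon_def vertex_def nth_eq_iff_index_eq)
  have line: "arc (linepath (vertex vs m) (vertex vs (Suc m)))"
    using v[of m "Suc m"] Suc.prems by (intro arc_linepath) simp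
  show ?case
  proof (cases "m = 0")
    case True
    then show ?thesis using line by (intro exI[of _ "linepath (vertex vs 0) (vertex vs 1)"])
      (auto simp: edge_def)
  next
    case False
    then obtain g where g: "arc g" "pathstart g = vertex vs 0" "pathfinish g = vertex vs m"
      "path_image g = (\<Union>j<m. edge vs j)"
      using Suc by auto
    \<comment> \<open>The new far end \<open>vertex vs (Suc m)\<close> differs from both ends of
      every earlier edge, so only \<open>vertex vs m\<close> remains.\<close>
    have "edge vs j \<inter> edge vs m \<subseteq> {vertex vs m}" if "j < m" for j
    proof -
      have "edge vs j \<inter> edge vs m \<subseteq>
          {vertex vs j, vertex vs (Suc j)} \<inter> {vertex vs m, vertex vs (Suc m)}"
        using s that Suc.prems by (simp add: simple_polygon_def)
      then show ?thesis
        using v[of j "Suc m"] v[of "Suc j" "Suc m"] that Suc.prems by fastforce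
    qed
    then have "arc (g +++ linepath (vertex vs m) (vertex vs (Suc m)))"
      using g line by (intro arc_join) (auto simp: edge_def)
    then show ?thesis
      using g by (intro exI[of _ "g +++ linepath (vertex vs m) (vertex vs (Suc m))"])
        (auto simp: path_image_join edge_def lessThan_Suc)
  qed
qed simp

lemma simple_polygon_path:
  assumes s: "simple_polygon vs"
  obtains g where "simple_path g" "pathfinish g = pathstart g"
    "path_image g = (\<Union>j<length vs. edge vs j)"
proof -
  define m where "m = length vs - 1"
  have n: "length vs = Suc m" "0 < m" "m < length vs"
    using s by (auto simp: simple_polygon_def m_def)
  obtain g where g: "arc g" "pathstart g = vertex vs 0" "pathfinish g = vertex vs m"
    "path_image g = (\<Union>j<m. edge vs j)"
    using simple_polygon_arc[OF s n(2,3)] by auto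
  have last: "vertex vs (Suc m) = vertex vs 0" by (simp add: vertex_def flip: n(1))
  have "vertex vs m \<noteq> vertex vs 0"
    using s n by (simp add: simple_polygon_def vertex_def nth_eq_iff_index_eq)
  then have line: "arc (linepath (vertex vs m) (vertex vs 0))" by (rule arc_linepath)
  \<comment> \<open>The closing edge may meet the arc at both of its ends, which is what joining to
    a loop permits.\<close>
  have "edge vs j \<inter> edge vs m \<subseteq> {vertex vs m, vertex vs 0}" if "j < m" for j
  proof -
    have "edge vs j \<inter> edge vs m \<subseteq>
        {vertex vs j, vertex vs (Suc j)} \<inter> {vertex vs m, vertex vs (Suc m)}"
      using s that n by (simp add: simple_polygon_def)
    then show ?thesis using last by auto
  qed
  then have "simple_path (g +++ linepath (vertex vs m) (vertex vs 0))"
    using g line last by (intro simple_path_join_loop) (auto simp: edge_def)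
  moreover have "path_image (g +++ linepath (vertex vs m) (vertex vs 0)) =
      (\<Union>j<length vs. edge vs j)"
    using g last unfolding n(1) by (auto simp: path_image_join edge_def lessThan_Suc)
  ultimately show ?thesis
    using that[of "g +++ linepath (vertex vs m) (vertex vs 0)"] g by simp
qed

text \<open>Serves to transfer the Jordan curve theorem from \<open>complex\<close> to
  \<open>real \<times> real\<close>. The component of \<open>z\<close> lies in the image of the
  component of \<open>k z\<close>, so it would be bounded if the latter were.\<close>

lemma outside_vimage_linear:
  fixes h :: "'a::euclidean_space \<Rightarrow> 'b::euclidean_space"
  assumes h: "linear h" and inv: "linear k" "\<And>x. k (h x) = x" "\<And>y. h (k y) = y"
    and z: "z \<in> outside (h ` S)"
  shows "k z \<in> outside S"
proof -
  have "connected_component_set (- (h ` S)) z \<subseteq> h ` connected_component_set (- S) (k z)"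
  proof -
    let ?C = "connected_component_set (- (h ` S)) z"
    have zn: "z \<notin> h ` S" using z outside_no_overlap by blast
    have "k ` ?C \<subseteq> connected_component_set (- S) (k z)"
    proof (rule connected_component_maximal)
      show "k z \<in> k ` ?C" using zn by auto
      show "connected (k ` ?C)"
        using inv(1) by (intro connected_continuous_image linear_continuous_on
            linear_conv_bounded_linear[THEN iffD1]) auto
      show "k ` ?C \<subseteq> - S"
      proof clarify
        fix y assume "connected_component (- h ` S) z y" "k y \<in> S"
        then have "h (k y) \<notin> h ` S" using connected_component_in inv(3) by fastforce
        then show False using \<open>k y \<in> S\<close> by blast
      qed
    qed
    then have "h ` k ` ?C \<subseteq> h ` connected_component_set (- S) (k z)" by (rule image_mono)
    then show ?thesis by (simp add: image_image inv(3))
  qed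
  moreover have "bounded (h ` T)" if "bounded T" for T
    using that h by (intro bounded_linear_image linear_conv_bounded_linear[THEN iffD1])
  moreover have "k z \<notin> S"
    using z outside_no_overlap[of "h ` S"] inv(3)[of z] by (metis IntI empty_iff imageI)
  ultimately show ?thesis using z bounded_subset by (auto simp: outside)
qed

text \<open>Such a point is outside the curve or on it, and by the Jordan curve theorem the curve is
  the frontier of its outside.\<close>

lemma simple_polygon_closure_outside:
  assumes s: "simple_polygon vs" and p: "p \<notin> polygonal_region vs"
  shows "p \<in> closure (outside (\<Union>j<length vs. edge vs j))"
proof -
  let ?S = "\<Union>j<length vs. edge vs j"
  define h where "h = (\<lambda>p::real \<times> real. Complex (fst p) (snd p))"
  define k where "k = (\<lambda>z. (Re z, Im z))"
  have lin: "linear h" "linear k"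
    by (auto intro!: linearI simp: h_def k_def complex_eq_iff)
  have inv: "k (h x) = x" "h (k z) = z" for x z by (simp_all add: h_def k_def)
  obtain g where g: "simple_path g" "pathfinish g = pathstart g" "path_image g = ?S"
    using simple_polygon_path[OF s] .
  have "inj h" using inv(1) by (metis injI)
  then have "simple_path (h \<circ> g)" using simple_path_linear_image_eq[OF lin(1)] g(1) by blast
  moreover have "pathfinish (h \<circ> g) = pathstart (h \<circ> g)"
    using g(2) by (simp add: pathfinish_def pathstart_def)
  ultimately have fr: "frontier (outside (h ` ?S)) = h ` ?S"
    using Jordan_inside_outside[of "h \<circ> g"] g(3) by (simp add: path_image_compose)
  have "p \<in> outside ?S \<or> p \<in> ?S"
    using p inside_Un_outside[of ?S] unfolding polygonal_region_def by blast
  then show ?thesis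
  proof
    assume "p \<in> ?S"
    then have "h p \<in> closure (outside (h ` ?S))"
      using fr unfolding frontier_def by blast
    then have "k (h p) \<in> k ` closure (outside (h ` ?S))" by blast
    also have "\<dots> \<subseteq> closure (k ` outside (h ` ?S))"
      using closure_linear_image_subset[OF lin(2)] .
    also have "\<dots> \<subseteq> closure (outside ?S)"
      using outside_vimage_linear[OF lin inv] by (intro closure_mono) blast
    finally show ?thesis by (simp add: inv)
  qed (use closure_subset in blast)
qed

section \<open>Finite grids and comparison of regions off the grid\<close>

lemma finite_gap:
  fixes X :: "real set"
  assumes "finite X"
  obtains e where "e > 0" "\<And>a a'. a \<in> X \<Longrightarrow> a' \<in> X \<Longrightarrow> a < a' \<Longrightarrow> a + e < a'"
proof -
  \<comment> \<open>The \<open>1\<close> keeps \<open>D\<close> nonempty when \<open>X\<close> has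
    fewer than two points. Half of \<open>Min D\<close> is taken below to make the inequality
    strict.\<close>
  define D where "D = insert 1 ((\<lambda>(a, a'). a' - a) ` {(a, a') \<in> X \<times> X. a < a'})"
  have D: "finite D" "D \<noteq> {}" "\<And>d. d \<in> D \<Longrightarrow> d > 0"
    using assms by (auto simp: D_def intro: finite_subset[of _ "X \<times> X"])
  have "Min D > 0" using D Min_in by blast
  moreover have "a + Min D / 2 < a'" if "a \<in> X" "a' \<in> X" "a < a'" for a a'
  proof -
    have "a' - a \<in> D" using that by (force simp: D_def)
    then have "Min D \<le> a' - a" using D(1) by simp
    then show ?thesis using \<open>Min D > 0\<close> by simp
  qed
  ultimately show ?thesis using that[of "Min D / 2"] by simp
qed

lemma open_off_grid:
  fixes U :: "(real \<times> real) set"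
  assumes "open U" "U \<noteq> {}" "finite X" "finite Y"
  obtains p where "p \<in> U" "fst p \<notin> X" "snd p \<notin> Y"
proof -
  obtain q where "q \<in> U" using assms(2) by blast
  then obtain A B where AB: "open A" "open B" "q \<in> A \<times> B" "A \<times> B \<subseteq> U"
    using assms(1) open_prod_elim by metis
  then have "A \<noteq> {}" "B \<noteq> {}" by auto
  then have "\<not> A \<subseteq> X" "\<not> B \<subseteq> Y"
    using AB(1,2) assms(3,4) finite_imp_not_open finite_subset by blast+
  then obtain x y where "x \<in> A" "x \<notin> X" "y \<in> B" "y \<notin> Y" by blast
  then show ?thesis using that[of "(x, y)"] AB(4) by auto
qed

text \<open>A point of \<open>P\<close> not in the region is a limit of points outside the curve.
  Then \<open>P\<close> meets the outside in a nonempty open set, which contains a point off the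
  grid, contrary to \<open>off\<close>.\<close>

lemma subset_polygonal_region:
  assumes vs: "simple_polygon vs" and P: "open P" and fin: "finite X" "finite Y"
    and off: "\<And>p. p \<in> P \<Longrightarrow> fst p \<notin> X \<Longrightarrow> snd p \<notin> Y \<Longrightarrow> p \<in> polygonal_region vs"
  shows "P \<subseteq> polygonal_region vs"
proof (rule subsetI, rule ccontr)
  let ?S = "\<Union>j<length vs. edge vs j"
  fix p assume p: "p \<in> P" "p \<notin> polygonal_region vs"
  have "closed ?S" by (intro closed_UN) (auto simp: edge_def)
  then have "open (P \<inter> outside ?S)" using P open_outside by blast
  moreover have "P \<inter> outside ?S \<noteq> {}"
    using simple_polygon_closure_outside[OF vs p(2)] p(1) P open_Int_closure_eq_empty by blast
  ultimately obtain q where "q \<in> P \<inter> outside ?S" "fst q \<notin> X" "snd q \<notin> Y"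
    using open_off_grid fin by metis
  then show False using off inside_Int_outside[of ?S] unfolding polygonal_region_def by blast
qed

section \<open>The frequency set and the conclusion\<close>

lemma hyperbolic_cross_subset_freq_set:
  assumes "(i + 1) * (j + 1) \<le> 2 * N"
  shows "(int i, int j) \<in> freq_set N"
proof -
  have N: "N \<ge> 1" using assms by (cases N) auto
  \<comment> \<open>The choice is \<open>j + 1\<close>, capped at the largest admissible index.
    Where the cap applies, \<open>j + 1 \<le> 2 * N\<close> still gives
    \<open>j \<le> 2 * r\<close>.\<close>
  define r where "r = min (j + 1) N"
  have r: "r \<in> {1..N}" using N by (auto simp: r_def)
  have "j + 1 \<le> (i + 1) * (j + 1)" by simp
  then have "j + 1 \<le> 2 * N" using assms by (rule order_trans)
  then have j: "int j \<le> 2 * int r" by (simp add: r_def min_def)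
  have "i * r \<le> (i + 1) * (j + 1)" unfolding r_def by (intro mult_mono) auto
  then have "real (i * r) \<le> real (2 * N)" using assms by (simp only: of_nat_le_iff)
  then have "real i \<le> real (2 * N) / real r" using r by (simp add: field_simps)
  then have "int i \<le> \<lfloor>real (2 * N) / real r\<rfloor>" by (simp add: le_floor_iff)
  then show ?thesis unfolding freq_set_def using r j by (intro UN_I[of r]) auto
qed

theorem corollary3p1:
  fixes N :: nat and P Q :: "(real \<times> real) set"
  assumes "N \<ge> 3"
    and "P \<in> axis_parallel_regions N" and "Q \<in> axis_parallel_regions N"
    and "\<And>k l. (k, l) \<in> freq_set N \<Longrightarrow>
           fourier (indicator P) (real_of_int k, real_of_int l)
             = fourier (indicator Q) (real_of_int k, real_of_int l)"
  shows "P = Q"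
proof -
  obtain vs where vs: "simple_polygon vs" "axis_parallel vs" "length vs \<le> N"
    "set vs \<subseteq> unit_square" "polygonal_region vs \<subseteq> unit_square" "P = polygonal_region vs"
    using assms(2) by (auto simp: axis_parallel_regions_def)
  obtain ws where ws: "simple_polygon ws" "axis_parallel ws" "length ws \<le> N"
    "set ws \<subseteq> unit_square" "polygonal_region ws \<subseteq> unit_square" "Q = polygonal_region ws"
    using assms(3) by (auto simp: axis_parallel_regions_def)
  define V where "V = set vs \<union> set ws"
  define X where "X = fst ` V"
  define Y where "Y = snd ` V"
  have V: "V \<subseteq> X \<times> Y" by (force simp: X_def Y_def)
  have XY: "finite X" "finite Y" "X \<subseteq> {0..<1}" "Y \<subseteq> {0..<1}"
    using vs(4) ws(4) by (auto simp: X_def Y_def V_def unit_square_def)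
  \<comment> \<open>One \<open>e\<close> serves both coordinates and both polygons.\<close>
  have "finite (X \<union> Y)" using XY by simp
  then obtain e where e: "e > 0"
    "\<And>a a'. a \<in> X \<union> Y \<Longrightarrow> a' \<in> X \<union> Y \<Longrightarrow> a < a' \<Longrightarrow> a + e < a'"
    by (rule finite_gap) blast
  interpret P: polygon_grid vs X Y e
    using vs XY V e by unfold_locales (auto simp: V_def)
  interpret Q: polygon_grid ws X Y e
    using ws XY V e by unfold_locales (auto simp: V_def)
  \<comment> \<open>The mixed differences of \<open>indicator P\<close> minus
    \<open>indicator Q\<close>, with support \<open>K\<close>. By \<open>jump_eq_0\<close> only
    vertices of one of the polygons contribute, which bounds the number of nodes by
    \<open>2 * N\<close>.\<close>
  define c where "c = (\<lambda>a b. jump (indicator P) e a b - jump (indicator Q) e a b)"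
  define K where "K = {(a, b) \<in> X \<times> Y. c a b \<noteq> 0}"
  have K: "K \<subseteq> X \<times> Y" "finite K"
    using XY by (auto simp: K_def intro: finite_subset[of _ "X \<times> Y"])
  have "(a, b) \<in> V" if ab: "(a, b) \<in> K" for a b
  proof (rule ccontr)
    assume "(a, b) \<notin> V"
    then show False
      using ab P.jump_eq_0[of a b] Q.jump_eq_0[of a b]
      by (simp add: K_def c_def V_def vs(6) ws(6))
  qed
  then have "K \<subseteq> V" by auto
  then have "card K \<le> card V" by (intro card_mono) (auto simp: V_def)
  also have "\<dots> \<le> length vs + length ws"
    unfolding V_def using card_Un_le[of "set vs" "set ws"] card_length[of vs] card_length[of ws]
    by linarith
  finally have cardK: "card K \<le> 2 * N" using vs(3) ws(3) by linarith
  have "K = {}"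
    using K(2)
  proof (rule hyperbolic_cross_separates[where u = "wave 1" and v = "wave 1" and c = c])
    have "fst ` K \<subseteq> {0..<1}" "snd ` K \<subseteq> {0..<1}" using K(1) XY(3,4) by auto
    then show "inj_on (wave 1) (fst ` K)" "inj_on (wave 1) (snd ` K)"
      using inj_on_subset[OF inj_on_wave] by blast+
    fix i j assume "(i + 1) * (j + 1) \<le> card K"
    then have "(int i, int j) \<in> freq_set N"
      using cardK by (intro hyperbolic_cross_subset_freq_set) linarith
    from assms(4)[OF this]
    have eq: "fourier (indicator P) (real i, real j) = fourier (indicator Q) (real i, real j)"
      by simp
    have "(\<Sum>(x, y)\<in>K. c x y * (wave 1 x ^ i * wave 1 y ^ j)) =
        (\<Sum>(x, y)\<in>X \<times> Y. c x y * (wave 1 x ^ i * wave 1 y ^ j))"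
      using XY(1,2) by (intro sum.mono_neutral_left) (auto simp: K_def)
    also have "\<dots> = (\<Sum>a\<in>X. \<Sum>b\<in>Y. c a b * (wave 1 a ^ i * wave 1 b ^ j))"
      by (simp add: sum.cartesian_product)
    \<comment> \<open>The two Fourier coefficients agree at \<open>(i, j)\<close>;
      \<open>fourier_jump\<close> holds for zero frequencies too.\<close>
    also have "\<dots> = 0"
      using P.fourier_jump[of i j] Q.fourier_jump[of i j] eq
      by (simp add: c_def vs(6) ws(6) left_diff_distrib sum_subtractf)
    finally show "(\<Sum>(x, y)\<in>K. c x y * (wave 1 x ^ i * wave 1 y ^ j)) = 0" .
  qed (auto simp: K_def)
  then have jump: "jump (indicator P) e a b = jump (indicator Q) e a b" if "a \<in> X" "b \<in> Y" for a b
    using that by (auto simp: K_def c_def)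
  \<comment> \<open>Off the grid lines both indicators are the same sum of jumps.\<close>
  have off: "p \<in> P \<longleftrightarrow> p \<in> Q" if p: "fst p \<notin> X" "snd p \<notin> Y" for p
  proof -
    have "(indicator P p :: complex) = indicator Q p"
      using P.expansion[OF p] Q.expansion[OF p] jump by (simp add: vs(6) ws(6))
    then show ?thesis by (auto simp: indicator_def split: if_splits)
  qed
  have "P \<subseteq> Q" "Q \<subseteq> P"
    using subset_polygonal_region[OF ws(1) P.open_region XY(1,2)]
      subset_polygonal_region[OF vs(1) Q.open_region XY(1,2)] off
    unfolding vs(6) ws(6) by blast+
  then show ?thesis by blast
qed

end
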